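(* Let $k=\mathbb{C}(A_1,\dots,A_m)$ and let $f_1,f_2,f_3,f_4\in k[q_0,q_1,q_2,q_3]$ be four quadrics in four unknowns. If $(s_0,s_1,s_2,s_3)\in\mathbf{V}(\langle f_1,f_2,f_3,f_4\rangle)$, then the univariate polynomial $$\det Dix(f_1,f_2,f_3,f_4;q_1,q_2,q_3)\in k[q_0]$$ vanishes at $q_0=s_0$.
   Context: $k=\mathbb{C}(A_1,\dots,A_m)$ is the field of rational functions in parameters $A_1,\dots,A_m$ (with $m\ge0$), and $\mathbf{V}(\langle f_1,\dots,f_4\rangle)$ is the set of common zeros of $f_1,\dots,f_4$ in $\bar k^4$, with $\bar k$ an algebraic closure of $k$. A quadric is a polynomial of total degree at most $2$ in the unknowns; a cubic is a polynomial of total degree at most $3$ in the unknowns. Definition of the Dixon matrix. Given quadrics $f_1,\dots,f_4$ in three unknowns $x_1,x_2,x_3$ (with coefficients in a coefficient ring containing any further parameters), fix an ordering of the twenty monomials of total degree at most $3$: $$x_1^3,x_1^2x_2,x_1^2x_3,x_1x_2^2,x_1x_2x_3,x_1x_3^2,x_2^3,x_2^2x_3,x_2x_3^2,x_3^3,x_1^2,x_1x_2,x_1x_3,x_2^2,x_2x_3,x_3^2,x_1,x_2,x_3,1.$$ The coefficient row vector of a cubic $g$ is the row vector of its twenty coefficients with respect to these monomials in this order. Let $U$ be the $4\times4$ matrix whose $i$-th row is $$\left[\tfrac{f_i(x_1,x_2,x_3)-f_i(y_1,x_2,x_3)}{x_1-y_1},\ \tfrac{f_i(y_1,x_2,x_3)-f_i(y_1,y_2,x_3)}{x_2-y_2},\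 \tfrac{f_i(y_1,y_2,x_3)-f_i(y_1,y_2,y_3)}{x_3-y_3},\ f_i(y_1,y_2,y_3)\right],$$ and write $\det U=\sum_{i,j,l}\psi_{ijl}\,y_1^iy_2^jy_3^l$, where the $\psi_{ijl}$ are polynomials in $x_1,x_2,x_3$. For $i+j+l\le1$ the $\psi_{ijl}$ are cubics. The Dixon matrix $Dix(f_1,f_2,f_3,f_4;x_1,x_2,x_3)$ is the $20\times20$ matrix whose $i$-th row is the coefficient row vector of $g_i$, where $g_i=f_i$ for $1\le i\le4$; $g_{4+i}=x_1f_i$, $g_{8+i}=x_2f_i$, $g_{12+i}=x_3f_i$ for $1\le i\le4$; and $g_{17}=\psi_{000}$, $g_{18}=\psi_{100}$, $g_{19}=\psi_{010}$, $g_{20}=\psi_{001}$. For quadrics in four unknowns $q_0,q_1,q_2,q_3$, the matrix $Dix(f_1,f_2,f_3,f_4;q_1,q_2,q_3)$ is formed by taking $(x_1,x_2,x_3)=(q_1,q_2,q_3)$ as the unknowns and regarding $q_0$ as a parameter in the coefficients; its entries, and hence its determinant, lie in $k[q_0]$. *)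

theory Defs
  imports
    "HOL-Library.Poly_Mapping"
    "HOL-Computational_Algebra.Fraction_Field"
    "HOL-Algebra.Algebraic_Closure_Type"
    "Jordan_Normal_Form.Determinant"
begin

section \<open>Multivariate polynomials\<close>

text \<open>
  Power products are finitely supported exponent functions. The variables are indexed by all
  natural numbers; \<open>mpolys_over\<close> restricts the coefficients and the variables.
\<close>

type_synonym 'a mpoly = "(nat \<Rightarrow>\<^sub>0 nat) \<Rightarrow>\<^sub>0 'a"

definition Var :: "nat \<Rightarrow> 'a::zero_neq_one mpoly" where
  "Var i = Poly_Mapping.single (Poly_Mapping.single i 1) 1"

definition Const :: "'a::zero \<Rightarrow> 'a mpoly" where
  "Const c = Poly_Mapping.single 0 c"

definition mpolys_over :: "'a::zero set \<Rightarrow> nat set \<Rightarrow> 'a mpoly set" where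
  "mpolys_over K I = {p. \<forall>m. Poly_Mapping.lookup p m \<in> K \<and>
                          (m \<in> Poly_Mapping.keys p \<longrightarrow> Poly_Mapping.keys m \<subseteq> I)}"

text \<open>The zero polynomial gets total degree \<open>0\<close>.\<close>

definition total_degree :: "'a::zero mpoly \<Rightarrow> nat" where
  "total_degree p =
     Max (insert 0 ((\<lambda>m. \<Sum>i\<in>Poly_Mapping.keys m. Poly_Mapping.lookup m i) ` Poly_Mapping.keys p))"

text \<open>Evaluation at the point \<open>s\<close>, after applying \<open>\<phi>\<close> to the coefficients.\<close>

definition mpoly_eval :: "('a::zero \<Rightarrow> 'b::comm_semiring_1) \<Rightarrow> (nat \<Rightarrow> 'b) \<Rightarrow> 'a mpoly \<Rightarrow> 'b" where
  "mpoly_eval \<phi> s p =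
     (\<Sum>m\<in>Poly_Mapping.keys p. \<phi> (Poly_Mapping.lookup p m) *
        (\<Prod>i\<in>Poly_Mapping.keys m. s i ^ Poly_Mapping.lookup m i))"

definition polys_over :: "'a::zero set \<Rightarrow> 'a poly set" where
  "polys_over K = {p. \<forall>i. Polynomial.coeff p i \<in> K}"


section \<open>The ground field and its algebraic closure\<close>

text \<open>
  A type cannot depend on the number \<open>m\<close> of parameters (and a type-level index set would rule
  out \<open>m = 0\<close>). We therefore work in the field of rational functions over \<open>\<complex>\<close> in the variables
  with arbitrary index; the field \<open>\<complex>(A\<^sub>1, \<dots>, A\<^sub>m)\<close> is its subfield of quotients of polynomials
  in the variables with indices \<open>1, \<dots>, m\<close>. The elements that are algebraic over it in an
  algebraically closed extension form an algebraic closure of it.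
\<close>

type_synonym ratfun = "complex mpoly fract"

definition ratfun_field :: "nat \<Rightarrow> ratfun set" where
  "ratfun_field m =
     {Fract p q | p q. p \<in> mpolys_over UNIV {1..m} \<and> q \<in> mpolys_over UNIV {1..m} \<and> q \<noteq> 0}"

definition ratfun_closure :: "nat \<Rightarrow> ratfun alg_closure set" where
  "ratfun_closure m =
     {z. \<exists>p \<in> polys_over (ratfun_field m). p \<noteq> 0 \<and> poly (map_poly to_ac p) z = 0}"

text \<open>The common zeros in affine \<open>4\<close>-space; the unknowns have the indices \<open>0, 1, 2, 3\<close>.\<close>

definition common_zeros ::
  "nat \<Rightarrow> ratfun mpoly set \<Rightarrow>
     (ratfun alg_closure \<times> ratfun alg_closure \<times> ratfun alg_closure \<times> ratfun alg_closure) set" where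
  "common_zeros m F =
     {(s0, s1, s2, s3). {s0, s1, s2, s3} \<subseteq> ratfun_closure m \<and>
        (\<forall>f\<in>F. mpoly_eval to_ac ((!) [s0, s1, s2, s3]) f = 0)}"


section \<open>The Dixon matrix\<close>

text \<open>
  The unknowns \<open>x\<^sub>1, x\<^sub>2, x\<^sub>3\<close> have the indices \<open>1, 2, 3\<close>. Polynomials in both the \<open>x\<^sub>i\<close> and the
  \<open>y\<^sub>i\<close> are represented as polynomials in the \<open>y\<^sub>i\<close> with coefficients that are polynomials in
  the \<open>x\<^sub>i\<close>, so \<open>y\<^sub>i\<close> is \<open>Var i\<close> and \<open>x\<^sub>i\<close> is \<open>Const (Var i)\<close>.

  \<open>subst_y j f\<close> replaces the first \<open>j\<close> of the unknowns \<open>x\<^sub>1, x\<^sub>2, x\<^sub>3\<close> in \<open>f\<close> by \<open>y\<^sub>1, \<dots>, y\<^sub>j\<close>.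
\<close>

definition subst_y :: "nat \<Rightarrow> 'a::idom mpoly \<Rightarrow> 'a mpoly mpoly" where
  "subst_y j f =
     mpoly_eval (\<lambda>c. Const (Const c)) (\<lambda>i. if i \<in> {1..j} then Var i else Const (Var i)) f"

text \<open>The exact quotient in an integral domain, meaningful if \<open>b \<noteq> 0\<close> divides \<open>a\<close>.\<close>

definition exact_quotient :: "'a::idom \<Rightarrow> 'a \<Rightarrow> 'a" where
  "exact_quotient a b = (THE c. a = c * b)"

lemma exact_quotient_eqI:
  assumes "a = c * b" and "b \<noteq> 0"
  shows "exact_quotient a b = c"
  unfolding exact_quotient_def using assms by (intro the_equality) auto

lemma Const_Var_minus_Var_neq_0:
  "Const (Var i :: 'a::idom mpoly) - Var i \<noteq> 0"
proof -
  have "Poly_Mapping.lookup (Const (Var i :: 'a mpoly) - Var i) (Poly_Mapping.single i 1) = -1"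
    by (auto simp: Const_def Var_def lookup_minus lookup_single when_def
             dest!: arg_cong[where f = "\<lambda>p. Poly_Mapping.lookup p i"])
  thus ?thesis
    by (metis lookup_zero neg_equal_0_iff_equal zero_neq_one)
qed

lemma prod_cong_dvd:
  fixes s t :: "'i \<Rightarrow> 'a::comm_ring_1"
  assumes "\<And>i. i \<in> A \<Longrightarrow> b dvd s i - t i"
  shows "b dvd (\<Prod>i\<in>A. s i) - (\<Prod>i\<in>A. t i)"
  using assms
proof (induction A rule: infinite_finite_induct)
  case (insert x A)
  have eq: "(\<Prod>i\<in>insert x A. s i) - (\<Prod>i\<in>insert x A. t i) =
      (s x - t x) * (\<Prod>i\<in>A. s i) + t x * ((\<Prod>i\<in>A. s i) - (\<Prod>i\<in>A. t i))"
    using insert.hyps by (simp add: algebra_simps)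
  show ?case
    unfolding eq using insert by (intro dvd_add dvd_mult2 dvd_mult) auto
qed auto

lemma mpoly_eval_cong_dvd:
  fixes s t :: "nat \<Rightarrow> 'b::comm_ring_1"
  assumes "\<And>i. b dvd s i - t i"
  shows "b dvd mpoly_eval \<phi> s p - mpoly_eval \<phi> t p"
proof -
  have "b dvd s i ^ n - t i ^ n" for i n
    using prod_cong_dvd[of "{..<n}" b "\<lambda>_. s i" "\<lambda>_. t i"] assms by simp
  hence "b dvd (\<Prod>i\<in>K. s i ^ e i) - (\<Prod>i\<in>K. t i ^ e i)" for K e
    by (intro prod_cong_dvd)
  thus ?thesis
    unfolding mpoly_eval_def sum_subtractf[symmetric] right_diff_distrib[symmetric]
    by (intro dvd_sum dvd_mult)
qed

text \<open>The quotients in the definition of \<open>dixon_U\<close> below are well defined.\<close>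

lemma dvd_subst_y_diff:
  "Const (Var (j + 1)) - Var (j + 1) dvd subst_y j f - subst_y (j + 1) f"
  unfolding subst_y_def by (rule mpoly_eval_cong_dvd) (auto simp: le_Suc_eq)

text \<open>Matrix indices start from \<open>0\<close> here.\<close>

definition dixon_U :: "'a::idom mpoly list \<Rightarrow> 'a mpoly mpoly mat" where
  "dixon_U fs = mat 4 4 (\<lambda>(i, j).
     if j < 3
     then exact_quotient (subst_y j (fs ! i) - subst_y (j + 1) (fs ! i))
                         (Const (Var (j + 1)) - Var (j + 1))
     else subst_y 3 (fs ! i))"

text \<open>The power product with exponents \<open>i, j, l\<close> at the indices \<open>1, 2, 3\<close>.\<close>

definition pp :: "nat \<times> nat \<times> nat \<Rightarrow> (nat \<Rightarrow>\<^sub>0 nat)" where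
  "pp = (\<lambda>(i, j, l). Poly_Mapping.single 1 i + Poly_Mapping.single 2 j + Poly_Mapping.single 3 l)"

definition dixon_psi :: "'a::idom mpoly list \<Rightarrow> nat \<times> nat \<times> nat \<Rightarrow> 'a mpoly" where
  "dixon_psi fs e = Poly_Mapping.lookup (det (dixon_U fs)) (pp e)"

definition cubic_exponents :: "(nat \<times> nat \<times> nat) list" where
  "cubic_exponents =
    [(3,0,0), (2,1,0), (2,0,1), (1,2,0), (1,1,1), (1,0,2), (0,3,0), (0,2,1), (0,1,2), (0,0,3),
     (2,0,0), (1,1,0), (1,0,1), (0,2,0), (0,1,1), (0,0,2),
     (1,0,0), (0,1,0), (0,0,1),
     (0,0,0)]"

definition coeff_row :: "'a::zero mpoly \<Rightarrow> 'a list" where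
  "coeff_row g = map (\<lambda>e. Poly_Mapping.lookup g (pp e)) cubic_exponents"

definition dixon_matrix ::
  "'a::idom mpoly \<Rightarrow> 'a mpoly \<Rightarrow> 'a mpoly \<Rightarrow> 'a mpoly \<Rightarrow> 'a mat" where
  "dixon_matrix f1 f2 f3 f4 =
     (let fs = [f1, f2, f3, f4];
          gs = fs @ map ((*) (Var 1)) fs @ map ((*) (Var 2)) fs @ map ((*) (Var 3)) fs @
               map (dixon_psi fs) [(0,0,0), (1,0,0), (0,1,0), (0,0,1)]
      in mat_of_rows_list 20 (map coeff_row gs))"

text \<open>
  A polynomial in \<open>q\<^sub>0, q\<^sub>1, q\<^sub>2, q\<^sub>3\<close> regarded as a polynomial in \<open>q\<^sub>1, q\<^sub>2, q\<^sub>3\<close> over the univariate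
  polynomials in \<open>q\<^sub>0\<close>.
\<close>

definition q0_as_parameter :: "'a::idom mpoly \<Rightarrow> 'a poly mpoly" where
  "q0_as_parameter f =
     mpoly_eval (\<lambda>c. Const [:c:]) (\<lambda>i. if i = 0 then Const [:0, 1:] else Var i) f"

definition dixon_matrix_q ::
  "'a::idom mpoly \<Rightarrow> 'a mpoly \<Rightarrow> 'a mpoly \<Rightarrow> 'a mpoly \<Rightarrow> 'a poly mat" where
  "dixon_matrix_q f1 f2 f3 f4 =
     dixon_matrix (q0_as_parameter f1) (q0_as_parameter f2)
                  (q0_as_parameter f3) (q0_as_parameter f4)"

end

theory Submission
  imports Defs
begin

text \<open>
  The theorem rests on two applications of one form of Cramer's rule, \<open>det_mult_vec_index\<close>: for a
  square matrix \<open>A\<close> over a commutative ring and a vector \<open>v\<close>, each \<open>det A * v\<^sub>k\<close> is a linear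
  combination of the entries of \<open>A v\<close>, whose coefficients come from the adjugate of \<open>A\<close>.

  The first application is to the matrix \<open>U\<close> and \<open>v = (x\<^sub>1 - y\<^sub>1, x\<^sub>2 - y\<^sub>2, x\<^sub>3 - y\<^sub>3, 1)\<close>. The
  difference quotients in a row of \<open>U\<close> telescope, so that \<open>U v\<close> is the vector of the
  \<open>f\<^sub>i(x\<^sub>1, x\<^sub>2, x\<^sub>3)\<close>. As the last entry of \<open>v\<close> is \<open>1\<close>, \<open>det U\<close> is a combination of the
  \<open>f\<^sub>i(x)\<close>, with coefficients that are polynomials in \<open>x\<close> and \<open>y\<close>. Comparing coefficients of the
  monomials in \<open>y\<close> shows that every \<open>\<psi>\<close> lies in the ideal of the \<open>f\<^sub>i\<close>
  (\<open>dixon_psi_in_ideal\<close>). Therefore all twenty polynomials whose coefficients form the rows of the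
  Dixon matrix vanish at every common zero of the \<open>f\<^sub>i\<close>.

  They are moreover cubics in \<open>x\<close>: in a row of \<open>U\<close> the first three entries are linear in \<open>x\<close>
  and the last one is free of \<open>x\<close>, so \<open>det U\<close> has degree at most \<open>3\<close> in \<open>x\<close>
  (\<open>dixon_psi_cubic\<close>). A cubic is determined by the twenty coefficients that are kept in its row,
  and the product of this row with the vector of the twenty monomials, evaluated at a point, is the
  value of the cubic there.

  Now put \<open>q\<^sub>0 = s\<^sub>0\<close> in the Dixon matrix and let \<open>v\<close> be the vector of the monomials at
  \<open>(s\<^sub>1, s\<^sub>2, s\<^sub>3)\<close>. The product is the zero vector, and the last entry of \<open>v\<close>, the value of
  the monomial \<open>1\<close>, is \<open>1\<close>. The second application of Cramer's rule shows that the determinant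
  is zero (\<open>det_dixon_matrix_vanishes\<close>).

  Both the degree bounds and the claim that the determinant has its coefficients in
  \<open>\<complex>(A\<^sub>1, \<dots>, A\<^sub>m)\<close> are instances of closure properties of a filtered ring; a subring is
  a filtered ring in which all the stages coincide.
\<close>

section \<open>Power products and evaluation\<close>

definition pp_degree :: "(nat \<Rightarrow>\<^sub>0 nat) \<Rightarrow> nat" where
  "pp_degree m = (\<Sum>i\<in>Poly_Mapping.keys m. Poly_Mapping.lookup m i)"

definition pp_eval :: "(nat \<Rightarrow> 'b::comm_semiring_1) \<Rightarrow> (nat \<Rightarrow>\<^sub>0 nat) \<Rightarrow> 'b" where
  "pp_eval s m = (\<Prod>i\<in>Poly_Mapping.keys m. s i ^ Poly_Mapping.lookup m i)"

lemma mpoly_eval_pp_eval: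
  "mpoly_eval \<phi> s p = (\<Sum>m\<in>Poly_Mapping.keys p. \<phi> (Poly_Mapping.lookup p m) * pp_eval s m)"
  by (simp add: mpoly_eval_def pp_eval_def)

lemma pp_degree_superset:
  assumes "finite A" "Poly_Mapping.keys m \<subseteq> A"
  shows "pp_degree m = (\<Sum>i\<in>A. Poly_Mapping.lookup m i)"
  unfolding pp_degree_def using assms
  by (intro sum.mono_neutral_left) (auto simp: in_keys_iff)

lemma pp_eval_superset:
  assumes "finite A" "Poly_Mapping.keys m \<subseteq> A"
  shows "pp_eval s m = (\<Prod>i\<in>A. s i ^ Poly_Mapping.lookup m i)"
  unfolding pp_eval_def using assms
  by (intro prod.mono_neutral_left) (auto simp: in_keys_iff)

lemma pp_degree_add: "pp_degree (m + n) = pp_degree m + pp_degree n"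
proof -
  let ?A = "Poly_Mapping.keys m \<union> Poly_Mapping.keys n"
  have "Poly_Mapping.keys (m + n) \<subseteq> ?A" by (rule keys_add)
  then show ?thesis
    by (simp add: pp_degree_superset[of ?A] lookup_add sum.distrib)
qed

lemma pp_eval_add: "pp_eval s (m + n) = pp_eval s m * pp_eval s n"
proof -
  let ?A = "Poly_Mapping.keys m \<union> Poly_Mapping.keys n"
  have "Poly_Mapping.keys (m + n) \<subseteq> ?A" by (rule keys_add)
  then show ?thesis
    by (simp add: pp_eval_superset[of ?A] lookup_add power_add prod.distrib)
qed

lemma pp_eval_zero [simp]: "pp_eval s 0 = 1"
  by (simp add: pp_eval_def)

lemma pp_degree_zero [simp]: "pp_degree 0 = 0"
  by (simp add: pp_degree_def)

text \<open>
  The products of such summands are monomials again, so this rule suits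
  multiplicative statements better than the induction over the updates of a mapping.
\<close>

lemma poly_mapping_sum_induct [case_names zero single add]:
  assumes "P 0" and "\<And>m c. P (Poly_Mapping.single m c)" and "\<And>p q. P p \<Longrightarrow> P q \<Longrightarrow> P (p + q)"
  shows "P p"
proof (induction p rule: update_induct)
  case (update f a b)
  have "Poly_Mapping.update a b f = Poly_Mapping.single a b + f"
    using update(1)
    by (intro poly_mapping_eqI) (auto simp: lookup_update lookup_add lookup_single when_def in_keys_iff)
  then show ?case using assms(2,3) update by simp
qed (rule assms(1))

context comm_ring_hom
begin

lemma mpoly_eval_single:
  "mpoly_eval hom s (Poly_Mapping.single m c) = hom c * pp_eval s m"
  by (simp add: mpoly_eval_pp_eval)

lemma mpoly_eval_add: "mpoly_eval hom s (p + q) = mpoly_eval hom s p + mpoly_eval hom s q"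
  unfolding mpoly_eval_pp_eval
  by (rule setsum_keys_plus_distrib) (auto simp: hom_add algebra_simps)

lemma mpoly_eval_mult: "mpoly_eval hom s (p * q) = mpoly_eval hom s p * mpoly_eval hom s q"
proof (induction p rule: poly_mapping_sum_induct)
  case (single m c)
  show ?case
  proof (induction q rule: poly_mapping_sum_induct)
    case (single n d)
    show ?case by (simp add: mult_single mpoly_eval_single pp_eval_add hom_mult mult_ac)
  qed (simp_all add: mpoly_eval_add algebra_simps, simp add: mpoly_eval_def)
qed (simp_all add: mpoly_eval_add algebra_simps, simp add: mpoly_eval_def)

lemma comm_ring_hom_mpoly_eval: "comm_ring_hom (mpoly_eval hom s)"
proof
  show "mpoly_eval hom s 1 = 1"
    using mpoly_eval_single[of s 0 1] by simp
qed (simp_all add: mpoly_eval_add mpoly_eval_mult, simp add: mpoly_eval_def)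

lemma mpoly_eval_Const: "mpoly_eval hom s (Const c) = hom c"
  by (simp add: Const_def mpoly_eval_single)

lemma mpoly_eval_Var: "mpoly_eval hom s (Var i) = s i"
  by (simp add: Var_def mpoly_eval_single pp_eval_def)

lemma hom_mpoly_eval:
  "hom (mpoly_eval \<phi> s p) = mpoly_eval (\<lambda>c. hom (\<phi> c)) (\<lambda>i. hom (s i)) p"
  by (simp add: mpoly_eval_def hom_sum hom_prod hom_mult hom_power)

end

lemma comm_ring_hom_Const: "comm_ring_hom (Const :: 'a::comm_ring_1 \<Rightarrow> 'a mpoly)"
  by standard (simp_all add: Const_def single_add mult_single)

lemma lookup_mult_Const:
  "Poly_Mapping.lookup (p * Const c) m = Poly_Mapping.lookup p m * (c :: 'a::comm_ring_1)"
proof -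
  have "p * Const c = Poly_Mapping.map ((*) c) p"
    by (simp add: mult_map_scale_conv_mult Const_def mult.commute)
  then show ?thesis by (simp add: map.rep_eq when_def mult.commute)
qed

section \<open>Degree filtrations\<close>

text \<open>
  \<open>F d\<close> stands for the elements of degree at most \<open>d\<close> whose coefficients lie in a given subring.
  Keeping the two conditions in one set lets a single computation with determinants and
  evaluations yield the degree and the domain of the coefficients together.
\<close>

locale filtered_ring =
  fixes F :: "nat \<Rightarrow> 'a::comm_ring_1 set"
  assumes zero_mem: "0 \<in> F d"
    and one_mem: "1 \<in> F 0"
    and add_mem: "a \<in> F d \<Longrightarrow> b \<in> F d \<Longrightarrow> a + b \<in> F d"
    and uminus_mem: "a \<in> F d \<Longrightarrow> - a \<in> F d"
    and mult_mem: "a \<in> F d \<Longrightarrow> b \<in> F e \<Longrightarrow> a * b \<in> F (d + e)"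
    and mono: "d \<le> e \<Longrightarrow> F d \<subseteq> F e"
begin

lemma diff_mem: "a \<in> F d \<Longrightarrow> b \<in> F d \<Longrightarrow> a - b \<in> F d"
  using add_mem[of a d "- b"] uminus_mem by simp

lemma sum_mem: "(\<And>i. i \<in> A \<Longrightarrow> f i \<in> F d) \<Longrightarrow> sum f A \<in> F d"
  by (induction A rule: infinite_finite_induct) (auto simp: zero_mem add_mem)

lemma prod_mem: "(\<And>i. i \<in> A \<Longrightarrow> f i \<in> F (d i)) \<Longrightarrow> prod f A \<in> F (sum d A)"
  by (induction A rule: infinite_finite_induct) (auto simp: one_mem mult_mem)

lemma power_mem: "a \<in> F d \<Longrightarrow> a ^ n \<in> F (n * d)"
  using prod_mem[of "{..<n}" "\<lambda>_. a" "\<lambda>_. d"] by simp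

lemma Sum_any_mem: "(\<And>i. f i \<in> F d) \<Longrightarrow> Sum_any f \<in> F d"
  by (simp add: Sum_any.expand_set sum_mem)

text \<open>
  Each term of the Leibniz expansion contains one entry of each column, so
  the bounds of the columns add up.
\<close>

lemma det_mem:
  assumes A: "A \<in> carrier_mat n n"
    and mem: "\<And>i j. i < n \<Longrightarrow> j < n \<Longrightarrow> A $$ (i, j) \<in> F (c j)"
  shows "det A \<in> F (\<Sum>j<n. c j)"
proof -
  have "signof p * (\<Prod>i = 0..<n. A $$ (i, p i)) \<in> F (\<Sum>j<n. c j)"
    if p: "p permutes {0..<n}" for p
  proof -
    have "(\<Prod>i = 0..<n. A $$ (i, p i)) \<in> F (\<Sum>i = 0..<n. c (p i))"
      using permutes_in_image[OF p] by (intro prod_mem mem) auto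
    also have "(\<Sum>i = 0..<n. c (p i)) = (\<Sum>j<n. c j)"
      using sum.permute[OF p, of c] by (simp add: o_def lessThan_atLeast0)
    finally show ?thesis by (simp add: sign_def uminus_mem)
  qed
  then show ?thesis
    unfolding det_def'[OF A] by (intro sum_mem) auto
qed

lemma pp_eval_mem:
  assumes "\<And>i. i \<in> Poly_Mapping.keys m \<Longrightarrow> s i \<in> F w"
  shows "pp_eval s m \<in> F (pp_degree m * w)"
  unfolding pp_eval_def pp_degree_def sum_distrib_right
  using assms by (intro prod_mem power_mem)

lemma mpoly_eval_mem:
  assumes "\<And>m. m \<in> Poly_Mapping.keys p \<Longrightarrow> \<phi> (Poly_Mapping.lookup p m) \<in> F 0"
    and "\<And>m i. m \<in> Poly_Mapping.keys p \<Longrightarrow> i \<in> Poly_Mapping.keys m \<Longrightarrow> s i \<in> F w"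
    and "\<And>m. m \<in> Poly_Mapping.keys p \<Longrightarrow> pp_degree m * w \<le> d"
  shows "mpoly_eval \<phi> s p \<in> F d"
  unfolding mpoly_eval_pp_eval
proof (intro sum_mem)
  fix m assume m: "m \<in> Poly_Mapping.keys p"
  have "\<phi> (Poly_Mapping.lookup p m) * pp_eval s m \<in> F (0 + pp_degree m * w)"
    using assms m by (intro mult_mem pp_eval_mem) auto
  then show "\<phi> (Poly_Mapping.lookup p m) * pp_eval s m \<in> F d"
    using mono assms(3)[OF m] by auto
qed

end

text \<open>
  The set \<open>M d\<close> restricts the power products and \<open>F d\<close> restricts the coefficients. The degree
  in the variables of the polynomial is controlled by \<open>M\<close>; for a polynomial in \<open>y\<close> over the
  polynomials in \<open>x\<close>, the choice \<open>M d = UNIV\<close> measures the degree in \<open>x\<close> alone.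
\<close>

definition mpoly_filtration ::
  "(nat \<Rightarrow> (nat \<Rightarrow>\<^sub>0 nat) set) \<Rightarrow> (nat \<Rightarrow> 'a::zero set) \<Rightarrow> nat \<Rightarrow> 'a mpoly set" where
  "mpoly_filtration M F d =
     {p. \<forall>m. Poly_Mapping.lookup p m \<in> F d \<and> (m \<in> Poly_Mapping.keys p \<longrightarrow> m \<in> M d)}"

lemma (in filtered_ring) filtered_ring_mpoly:
  assumes M0: "0 \<in> M 0"
    and Madd: "\<And>d e m n. m \<in> M d \<Longrightarrow> n \<in> M e \<Longrightarrow> m + n \<in> M (d + e)"
    and Mmono: "\<And>d e. d \<le> e \<Longrightarrow> M d \<subseteq> M e"
  shows "filtered_ring (mpoly_filtration M F)"
proof
  fix d e :: nat and p q :: "'a mpoly"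
  show "0 \<in> mpoly_filtration M F d"
    by (simp add: mpoly_filtration_def zero_mem)
  show "1 \<in> mpoly_filtration M F 0"
    using M0 by (auto simp: mpoly_filtration_def lookup_one when_def zero_mem one_mem)
  show "d \<le> e \<Longrightarrow> mpoly_filtration M F d \<subseteq> mpoly_filtration M F e"
    using mono Mmono by (fastforce simp: mpoly_filtration_def)
  assume p: "p \<in> mpoly_filtration M F d"
  show "- p \<in> mpoly_filtration M F d"
    using p by (auto simp: mpoly_filtration_def uminus_mem)
  show "p + q \<in> mpoly_filtration M F d" if "q \<in> mpoly_filtration M F d"
    using p that keys_add[of p q] by (auto simp: mpoly_filtration_def lookup_add add_mem)
  assume q: "q \<in> mpoly_filtration M F e"
  have "Poly_Mapping.lookup (p * q) m \<in> F (d + e)" for m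
    unfolding lookup_mult using p q
    by (intro Sum_any_mem mult_mem) (auto simp: mpoly_filtration_def when_def zero_mem)
  moreover have "m \<in> M (d + e)" if "m \<in> Poly_Mapping.keys (p * q)" for m
    using that keys_mult[of p q] p q Madd by (auto simp: mpoly_filtration_def)
  ultimately show "p * q \<in> mpoly_filtration M F (d + e)"
    by (simp add: mpoly_filtration_def)
qed

text \<open>
  The degree filtration of an ideal serves to bound the degree of the quotients
  of \<open>f(s) - f(t)\<close>, without writing these quotients down.
\<close>

locale filtered_ideal = filtered_ring F for F :: "nat \<Rightarrow> 'a::comm_ring_1 set" +
  fixes H :: "nat \<Rightarrow> 'a set"
  assumes ideal_zero_mem: "0 \<in> H d"
    and ideal_add_mem: "a \<in> H d \<Longrightarrow> b \<in> H d \<Longrightarrow> a + b \<in> H d"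
    and ideal_mult_mem: "a \<in> F d \<Longrightarrow> b \<in> H e \<Longrightarrow> a * b \<in> H (d + e)"
    and ideal_mono: "d \<le> e \<Longrightarrow> H d \<subseteq> H e"
begin

text \<open>
  Exchanging the factors \<open>f i\<close> for \<open>g i\<close> one at a time writes the difference as a
  sum of products, each with exactly one factor \<open>f i - g i\<close>.
\<close>

lemma prod_diff_mem:
  assumes "\<And>i. i \<in> A \<Longrightarrow> f i \<in> F (d i)" "\<And>i. i \<in> A \<Longrightarrow> g i \<in> F (d i)"
    and "\<And>i. i \<in> A \<Longrightarrow> f i - g i \<in> H (d i)"
  shows "prod f A - prod g A \<in> H (sum d A)"
  using assms
proof (induction A rule: infinite_finite_induct)
  case (insert x A)
  have "prod f (insert x A) - prod g (insert x A) =
      prod f A * (f x - g x) + g x * (prod f A - prod g A)"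
    using insert.hyps by (simp add: algebra_simps)
  moreover have "prod f A * (f x - g x) \<in> H (sum d A + d x)"
    using insert.prems by (intro ideal_mult_mem prod_mem) auto
  moreover have "g x * (prod f A - prod g A) \<in> H (d x + sum d A)"
    using insert by (intro ideal_mult_mem) auto
  ultimately show ?case
    using insert.hyps by (simp add: ideal_add_mem add.commute)
qed (auto simp: ideal_zero_mem)

lemma mpoly_eval_diff_mem:
  assumes coeff: "\<And>m. m \<in> Poly_Mapping.keys p \<Longrightarrow> \<phi> (Poly_Mapping.lookup p m) \<in> F 0"
    and vars: "\<And>m. m \<in> Poly_Mapping.keys p \<Longrightarrow> Poly_Mapping.keys m \<subseteq> I"
    and deg: "\<And>m. m \<in> Poly_Mapping.keys p \<Longrightarrow> pp_degree m \<le> d"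
    and s: "\<And>i. i \<in> I \<Longrightarrow> s i \<in> F 1" and t: "\<And>i. i \<in> I \<Longrightarrow> t i \<in> F 1"
    and diff: "\<And>i. i \<in> I \<Longrightarrow> s i - t i \<in> H 1"
  shows "mpoly_eval \<phi> s p - mpoly_eval \<phi> t p \<in> H d"
proof -
  have sum_mem: "sum f A \<in> H d" if "\<And>i. i \<in> A \<Longrightarrow> f i \<in> H d" for f :: "_ \<Rightarrow> 'a" and A
    using that by (induction A rule: infinite_finite_induct)
      (auto simp: ideal_zero_mem ideal_add_mem)
  have "\<phi> (Poly_Mapping.lookup p m) * (pp_eval s m - pp_eval t m) \<in> H d"
    if m: "m \<in> Poly_Mapping.keys p" for m
  proof -
    have "s i ^ n - t i ^ n \<in> H n" if "i \<in> I" for i n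
      using prod_diff_mem[of "{..<n}" "\<lambda>_. s i" "\<lambda>_. 1" "\<lambda>_. t i"] s t diff that by simp
    then have "pp_eval s m - pp_eval t m \<in> H (pp_degree m)"
      unfolding pp_eval_def pp_degree_def
      using vars[OF m] power_mem[OF s] power_mem[OF t] by (intro prod_diff_mem) auto
    then have "pp_eval s m - pp_eval t m \<in> H d"
      using ideal_mono deg[OF m] by auto
    then show ?thesis using ideal_mult_mem[OF coeff[OF m]] by fastforce
  qed
  then show ?thesis
    unfolding mpoly_eval_pp_eval sum_subtractf[symmetric] right_diff_distrib[symmetric]
    by (rule sum_mem)
qed

end

text \<open>
  The multiples of an element \<open>b\<close> of degree \<open>1\<close>, filtered so that the quotient by \<open>b\<close> has degree
  one less than the multiple. In degree \<open>0\<close> the only multiple is \<open>0\<close>, as if the quotient had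
  degree \<open>-1\<close>.
\<close>

lemma (in filtered_ring) filtered_ideal_multiples:
  "filtered_ideal F (\<lambda>d. {Q * b |Q. case d of 0 \<Rightarrow> Q = 0 | Suc d' \<Rightarrow> Q \<in> F d'})"
proof (unfold_locales, goal_cases)
  case (1 d)
  show ?case by (intro CollectI exI[of _ 0]) (auto simp: zero_mem split: nat.split)
next
  case (2 a d c)
  then obtain P Q where "a = P * b" "c = Q * b" "case d of 0 \<Rightarrow> P = 0 | Suc d' \<Rightarrow> P \<in> F d'"
    "case d of 0 \<Rightarrow> Q = 0 | Suc d' \<Rightarrow> Q \<in> F d'" by blast
  then show ?case
    by (intro CollectI exI[of _ "P + Q"]) (auto simp: add_mem distrib_right split: nat.splits)
next
  case (3 a d c e)
  then obtain Q where "c = Q * b" "case e of 0 \<Rightarrow> Q = 0 | Suc d' \<Rightarrow> Q \<in> F d'" by blast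
  with 3 show ?case
    by (intro CollectI exI[of _ "a * Q"])
      (auto simp: mult_mem zero_mem mult.assoc split: nat.splits)
next
  case (4 d e)
  show ?case
  proof
    fix a assume "a \<in> {Q * b |Q. case d of 0 \<Rightarrow> Q = 0 | Suc d' \<Rightarrow> Q \<in> F d'}"
    then obtain Q where "a = Q * b" "case d of 0 \<Rightarrow> Q = 0 | Suc d' \<Rightarrow> Q \<in> F d'" by blast
    with 4 mono show "a \<in> {Q * b |Q. case e of 0 \<Rightarrow> Q = 0 | Suc d' \<Rightarrow> Q \<in> F d'}"
      by (intro CollectI exI[of _ Q]) (auto simp: zero_mem split: nat.splits)
  qed
qed

section \<open>Subrings\<close>

abbreviation unital_subring :: "'a::comm_ring_1 set \<Rightarrow> bool" where
  "unital_subring R \<equiv> filtered_ring (\<lambda>_. R)"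

lemma subring_UNIV: "unital_subring UNIV"
  by standard auto

lemma subring_mpolys_over:
  assumes "unital_subring R"
  shows "unital_subring (mpolys_over R I)"
proof -
  have "filtered_ring (mpoly_filtration (\<lambda>_. {m. Poly_Mapping.keys m \<subseteq> I}) (\<lambda>_. R))"
    by (intro filtered_ring.filtered_ring_mpoly[OF assms]) (auto dest!: keys_add[THEN subsetD])
  also have "mpoly_filtration (\<lambda>_. {m. Poly_Mapping.keys m \<subseteq> I}) (\<lambda>_. R) = (\<lambda>_. mpolys_over R I)"
    by (auto simp: mpoly_filtration_def mpolys_over_def fun_eq_iff)
  finally show ?thesis .
qed

lemma subring_polys_over:
  assumes "unital_subring R"
  shows "unital_subring (polys_over R)"
proof -
  interpret filtered_ring "\<lambda>_. R" by (rule assms)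
  show ?thesis
    by standard
      (auto simp: polys_over_def zero_mem one_mem add_mem uminus_mem coeff_mult coeff_1
        intro!: sum_mem mult_mem)
qed

text \<open>
  A sum or product of fractions has the product of the denominators as a denominator, and this is
  again a nonzero polynomial in the same parameters.
\<close>

lemma subring_ratfun_field: "unital_subring (ratfun_field m)"
proof -
  define P where "P = mpolys_over (UNIV :: complex set) {1..m}"
  interpret filtered_ring "\<lambda>_. P"
    unfolding P_def by (rule subring_mpolys_over[OF subring_UNIV])
  have intro: "Fract p q \<in> ratfun_field m" if "p \<in> P" "q \<in> P" "q \<noteq> 0" for p q
    using that unfolding ratfun_field_def P_def by blast
  have elim: "\<exists>p q. x = Fract p q \<and> p \<in> P \<and> q \<in> P \<and> q \<noteq> 0" if "x \<in> ratfun_field m" for x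
    using that unfolding ratfun_field_def P_def by blast
  show ?thesis
  proof
    show "0 \<in> ratfun_field m" "1 \<in> ratfun_field m"
      unfolding Zero_fract_def One_fract_def by (auto intro: intro zero_mem one_mem)
    fix a b assume a: "a \<in> ratfun_field m"
    then obtain p q where pq: "a = Fract p q" "p \<in> P" "q \<in> P" "q \<noteq> 0" using elim by blast
    then show "- a \<in> ratfun_field m" by (auto intro: intro uminus_mem)
    assume "b \<in> ratfun_field m"
    then obtain r t where "b = Fract r t" "r \<in> P" "t \<in> P" "t \<noteq> 0" using elim by blast
    with pq show "a + b \<in> ratfun_field m" "a * b \<in> ratfun_field m"
      by (auto intro!: intro add_mem mult_mem)
  qed auto
qed

definition bounded_mpolys :: "'a::zero set \<Rightarrow> nat set \<Rightarrow> nat \<Rightarrow> 'a mpoly set" where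
  "bounded_mpolys R I =
     mpoly_filtration (\<lambda>d. {m. Poly_Mapping.keys m \<subseteq> I \<and> pp_degree m \<le> d}) (\<lambda>_. R)"

lemma bounded_mpolys_iff:
  "p \<in> bounded_mpolys R I d \<longleftrightarrow>
     p \<in> mpolys_over R I \<and> (\<forall>m\<in>Poly_Mapping.keys p. pp_degree m \<le> d)"
  by (auto simp: bounded_mpolys_def mpoly_filtration_def mpolys_over_def)

lemma bounded_mpolysD:
  assumes "p \<in> bounded_mpolys R I d"
  shows "Poly_Mapping.lookup p m \<in> R"
    and "m \<in> Poly_Mapping.keys p \<Longrightarrow> Poly_Mapping.keys m \<subseteq> I"
    and "m \<in> Poly_Mapping.keys p \<Longrightarrow> pp_degree m \<le> d"
  using assms by (auto simp: bounded_mpolys_def mpoly_filtration_def)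

lemma filtered_ring_bounded_mpolys:
  assumes "unital_subring R"
  shows "filtered_ring (bounded_mpolys R I)"
  unfolding bounded_mpolys_def
  by (intro filtered_ring.filtered_ring_mpoly[OF assms])
    (auto simp: pp_degree_add dest!: keys_add[THEN subsetD])

lemma Const_mem_bounded_mpolys:
  assumes "unital_subring R" "c \<in> R"
  shows "Const c \<in> bounded_mpolys R I d"
  using filtered_ring.zero_mem[OF assms(1)] assms(2)
  by (auto simp: bounded_mpolys_def mpoly_filtration_def Const_def lookup_single when_def
      split: if_splits)

lemma Var_mem_bounded_mpolys:
  assumes "unital_subring R" "i \<in> I"
  shows "Var i \<in> bounded_mpolys R I 1"
  using filtered_ring.zero_mem[OF assms(1)] filtered_ring.one_mem[OF assms(1)] assms(2)
  by (auto simp: bounded_mpolys_def mpoly_filtration_def Var_def lookup_single when_def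
      pp_degree_def split: if_splits)

section \<open>The Dixon polynomials\<close>

text \<open>
  Multiply \<open>A v\<close> by the adjugate of \<open>A\<close>: the result is \<open>det A\<close> times \<open>v\<close>.
\<close>

lemma det_mult_vec_index:
  assumes A: "A \<in> carrier_mat n n" and v: "v \<in> carrier_vec n" and k: "k < n"
  shows "det A * v $ k = (\<Sum>i<n. adj_mat A $$ (k, i) * (A *\<^sub>v v) $ i)"
proof -
  have adj: "adj_mat A \<in> carrier_mat n n" by (rule adj_mat(1)[OF A])
  have "det A \<cdot>\<^sub>v v = (det A \<cdot>\<^sub>m 1\<^sub>m n) *\<^sub>v v"
    using v by (auto simp: scalar_prod_def lessThan_atLeast0 if_distrib[of "\<lambda>x. _ * x * _"]
        if_distrib[of "\<lambda>x. x * _"] cong: if_cong intro!: eq_vecI)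
  also have "\<dots> = adj_mat A *\<^sub>v (A *\<^sub>v v)"
    using adj_mat(3)[OF A] assoc_mult_mat_vec[OF adj A v] by simp
  finally have "det A * v $ k = (adj_mat A *\<^sub>v (A *\<^sub>v v)) $ k"
    using v k by (metis carrier_vecD index_smult_vec(1))
  also have "\<dots> = (\<Sum>i<n. adj_mat A $$ (k, i) * (A *\<^sub>v v) $ i)"
    using adj A k by (auto simp: scalar_prod_def lessThan_atLeast0 intro!: sum.cong)
  finally show ?thesis .
qed

lemma dixon_U_carrier: "dixon_U fs \<in> carrier_mat 4 4"
  by (simp add: dixon_U_def)

lemma dixon_U_quotient:
  assumes "i < 4" "j < 3"
  shows "dixon_U fs $$ (i, j) * (Const (Var (j + 1)) - Var (j + 1)) =
           subst_y j (fs ! i) - subst_y (j + 1) (fs ! i)"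
proof -
  obtain Q where "subst_y j (fs ! i) - subst_y (j + 1) (fs ! i) =
      Q * (Const (Var (j + 1)) - Var (j + 1))"
    using dvd_subst_y_diff[of j "fs ! i"] by (metis dvdE mult.commute)
  moreover from this have "dixon_U fs $$ (i, j) = Q"
    using assms exact_quotient_eqI[OF _ Const_Var_minus_Var_neq_0, of _ Q "j + 1"]
    by (simp add: dixon_U_def)
  ultimately show ?thesis by simp
qed

text \<open>
  Multiplying the quotients by their denominators leaves
  \<open>(f(x\<^sub>1, x\<^sub>2, x\<^sub>3) - f(y\<^sub>1, x\<^sub>2, x\<^sub>3)) + (f(y\<^sub>1, x\<^sub>2, x\<^sub>3) - f(y\<^sub>1, y\<^sub>2, x\<^sub>3)) +
  (f(y\<^sub>1, y\<^sub>2, x\<^sub>3) - f(y\<^sub>1, y\<^sub>2, y\<^sub>3)) + f(y\<^sub>1, y\<^sub>2, y\<^sub>3)\<close>, which telescopes to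
  \<open>f(x\<^sub>1, x\<^sub>2, x\<^sub>3)\<close>.
\<close>

lemma dixon_U_mult_vec:
  assumes i: "i < 4"
  shows "(dixon_U fs *\<^sub>v vec 4 (\<lambda>j. if j < 3 then Const (Var (j + 1)) - Var (j + 1) else 1)) $ i =
           subst_y 0 (fs ! i)"
proof -
  have "(dixon_U fs *\<^sub>v vec 4 (\<lambda>j. if j < 3 then Const (Var (j + 1)) - Var (j + 1) else 1)) $ i =
      (\<Sum>j<3. dixon_U fs $$ (i, j) * (Const (Var (j + 1)) - Var (j + 1))) + dixon_U fs $$ (i, 3)"
    using i dixon_U_carrier[of fs]
    by (simp add: scalar_prod_def atLeast0LessThan eval_nat_numeral)
  also have "(\<Sum>j<3. dixon_U fs $$ (i, j) * (Const (Var (j + 1)) - Var (j + 1))) =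
      (\<Sum>j<3. subst_y j (fs ! i) - subst_y (Suc j) (fs ! i))"
    using dixon_U_quotient[OF i] by (intro sum.cong) auto
  also have "\<dots> = subst_y 0 (fs ! i) - subst_y 3 (fs ! i)"
    by (simp add: eval_nat_numeral)
  finally show ?thesis using i by (simp add: dixon_U_def)
qed

lemma subst_y_0: "subst_y 0 f = Const (mpoly_eval Const Var f)"
proof -
  interpret comm_ring_hom "Const :: 'a mpoly \<Rightarrow> 'a mpoly mpoly" by (rule comm_ring_hom_Const)
  show ?thesis by (simp add: subst_y_def hom_mpoly_eval)
qed

text \<open>
  By Cramer's rule \<open>det U\<close> is a combination of the \<open>f\<^sub>i(x)\<close>. These are constants with respect to
  \<open>y\<close>, so taking the coefficient of a monomial in \<open>y\<close> only affects the cofactors. The polynomial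
  \<open>mpoly_eval Const Var f\<close> is \<open>f\<close> itself, in the form in which it arises from \<open>subst_y\<close>.
\<close>

lemma dixon_psi_in_ideal:
  "\<exists>c. dixon_psi fs e = (\<Sum>i<4. c i * mpoly_eval Const Var (fs ! i))"
proof -
  define v where "v = vec 4 (\<lambda>j. if j < 3 then Const (Var (j + 1)) - Var (j + 1)
    else 1 :: 'a mpoly mpoly)"
  have "det (dixon_U fs) = det (dixon_U fs) * v $ 3"
    by (simp add: v_def)
  also have "\<dots> = (\<Sum>i<4. adj_mat (dixon_U fs) $$ (3, i) * (dixon_U fs *\<^sub>v v) $ i)"
    by (intro det_mult_vec_index dixon_U_carrier) (auto simp: v_def)
  also have "\<dots> = (\<Sum>i<4. adj_mat (dixon_U fs) $$ (3, i) * Const (mpoly_eval Const Var (fs ! i)))"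
    unfolding v_def by (intro sum.cong refl) (simp add: dixon_U_mult_vec[simplified] subst_y_0)
  finally show ?thesis
    unfolding dixon_psi_def by (auto simp: lookup_sum lookup_mult_Const)
qed

lemma dixon_psi_vanishes:
  assumes "comm_ring_hom \<phi>" and zero: "\<And>i. i < 4 \<Longrightarrow> mpoly_eval \<phi> s (fs ! i) = 0"
  shows "mpoly_eval \<phi> s (dixon_psi fs e) = 0"
proof -
  interpret \<phi>: comm_ring_hom \<phi> by fact
  interpret ev: comm_ring_hom "mpoly_eval \<phi> s" by (rule \<phi>.comm_ring_hom_mpoly_eval)
  obtain c where c: "dixon_psi fs e = (\<Sum>i<4. c i * mpoly_eval Const Var (fs ! i))"
    using dixon_psi_in_ideal by blast
  have "mpoly_eval \<phi> s (mpoly_eval Const Var f) = mpoly_eval \<phi> s f" for f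
    by (simp add: ev.hom_mpoly_eval \<phi>.mpoly_eval_Const \<phi>.mpoly_eval_Var)
  then show ?thesis
    by (simp add: c ev.hom_sum ev.hom_mult zero)
qed

text \<open>
  The degree in \<open>x\<close> is at most \<open>1\<close> in each of the first three columns of \<open>U\<close>, since dividing by
  \<open>x\<^sub>j - y\<^sub>j\<close> lowers the degree \<open>2\<close> of the numerator, and it is \<open>0\<close> in the last column.
\<close>

lemma dixon_psi_cubic:
  assumes R: "unital_subring R" and fs: "\<And>i. i < 4 \<Longrightarrow> fs ! i \<in> bounded_mpolys R {1, 2, 3} 2"
  shows "dixon_psi fs e \<in> bounded_mpolys R {1, 2, 3} 3"
proof -
  \<comment> \<open>\<open>G d\<close> consists of the polynomials in \<open>x\<close> and \<open>y\<close> of degree at most \<open>d\<close> in \<open>x\<close>.\<close>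
  define D where "D = bounded_mpolys R {1, 2, 3::nat}"
  define G where "G = mpoly_filtration (\<lambda>_. UNIV) D"
  interpret D: filtered_ring D
    unfolding D_def by (rule filtered_ring_bounded_mpolys[OF R])
  interpret G: filtered_ring G
    unfolding G_def by (rule D.filtered_ring_mpoly) auto
  have Const_mem: "Const p \<in> G d" if "p \<in> D d" for p d
    using that D.zero_mem
    by (auto simp: G_def mpoly_filtration_def Const_def lookup_single when_def)
  have y_mem: "Var i \<in> G d" for i d
  proof -
    have "Var i \<in> G 0"
      using D.zero_mem D.one_mem
      by (auto simp: G_def mpoly_filtration_def Var_def lookup_single when_def)
    then show ?thesis using G.mono[of 0 d] by auto
  qed
  have x_mem: "Const (Var i) \<in> G 1" if "i \<in> {1, 2, 3}" for i
    unfolding D_def by (intro Const_mem) (use that in \<open>simp only: D_def Var_mem_bounded_mpolys[OF R]\<close>)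
  have coeff: "Const (Const (Poly_Mapping.lookup f m)) \<in> G 0" if "f \<in> D 2" for f m
    using that unfolding D_def
    by (intro Const_mem) (simp add: D_def Const_mem_bounded_mpolys[OF R] bounded_mpolysD(1))
  have fsD: "fs ! i \<in> D 2" if "i < 4" for i
    using fs[OF that] by (simp add: D_def)
  have vars: "Poly_Mapping.keys m \<subseteq> {1, 2, 3}" and deg: "pp_degree m \<le> 2"
    if "f \<in> D 2" "m \<in> Poly_Mapping.keys f" for f m
    using that bounded_mpolysD(2,3) unfolding D_def by blast+
  have "dixon_U fs $$ (i, j) \<in> G (if j < 3 then 1 else 0)" if ij: "i < 4" "j < 4" for i j
  proof (cases "j < 3")
    case True
    define b where "b = Const (Var (j + 1)) - (Var (j + 1) :: 'a mpoly mpoly)"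
    define H where "H = (\<lambda>d. {Q * b |Q. case d of 0 \<Rightarrow> Q = 0 | Suc d' \<Rightarrow> Q \<in> G d'})"
    interpret H: filtered_ideal G H
      unfolding H_def by (rule G.filtered_ideal_multiples)
    have "b \<noteq> 0"
      unfolding b_def by (rule Const_Var_minus_Var_neq_0)
    have "b \<in> H 1"
      using G.one_mem by (auto simp: H_def intro!: exI[of _ 1])
    have "subst_y j (fs ! i) - subst_y (j + 1) (fs ! i) \<in> H 2"
      unfolding subst_y_def
    proof (rule H.mpoly_eval_diff_mem[where I = "{1, 2, 3}"])
      fix k :: nat assume "k \<in> {1, 2, 3}"
      \<comment> \<open>The two substitutions differ only at \<open>x\<^sub>k\<close> with \<open>k = j + 1\<close>, where their difference is \<open>b\<close>.\<close>
      consider "k \<le> j" | "k = j + 1" | "k > j + 1" by linarith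
      then show "(if k \<in> {1..j} then Var k else Const (Var k)) -
          (if k \<in> {1..j + 1} then Var k else Const (Var k)) \<in> H 1"
        using \<open>b \<in> H 1\<close> H.ideal_zero_mem[of 1] by cases (simp_all add: b_def)
    qed (use coeff vars deg fsD[OF ij(1)] x_mem y_mem in \<open>simp_all\<close>)
    then have "\<exists>Q. Q \<in> G 1 \<and> subst_y j (fs ! i) - subst_y (j + 1) (fs ! i) = Q * b"
      unfolding H_def by (auto simp: numeral_2_eq_2)
    then obtain Q where Q: "Q \<in> G 1" "subst_y j (fs ! i) - subst_y (j + 1) (fs ! i) = Q * b"
      by blast
    then have "dixon_U fs $$ (i, j) = Q"
      using dixon_U_quotient[OF ij(1) True, of fs, folded b_def] \<open>b \<noteq> 0\<close> by simp
    with Q True show ?thesis by simp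
  next
    case False
    have "subst_y 3 (fs ! i) \<in> G 0"
      unfolding subst_y_def
    proof (rule G.mpoly_eval_mem[where w = 0])
      fix m k assume "m \<in> Poly_Mapping.keys (fs ! i)" "k \<in> Poly_Mapping.keys m"
      then have "k \<in> {1, 2, 3}" using vars[OF fsD[OF ij(1)]] by blast
      then have "k \<in> {1..3}" by auto
      then show "(if k \<in> {1..3} then Var k else Const (Var k)) \<in> G 0" by (simp add: y_mem)
    qed (simp_all add: coeff fsD[OF ij(1)])
    with False ij show ?thesis by (simp add: dixon_U_def)
  qed
  then have "det (dixon_U fs) \<in> G (\<Sum>j<(4::nat). if j < 3 then 1 else 0)"
    by (rule G.det_mem[OF dixon_U_carrier])
  then have "det (dixon_U fs) \<in> G 3"
    by (simp add: eval_nat_numeral)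
  then show ?thesis
    by (simp add: dixon_psi_def G_def mpoly_filtration_def D_def)
qed

section \<open>The Dixon matrix\<close>

definition dixon_rows :: "'a::idom mpoly list \<Rightarrow> 'a mpoly list" where
  "dixon_rows fs = fs @ map ((*) (Var 1)) fs @ map ((*) (Var 2)) fs @ map ((*) (Var 3)) fs @
     map (dixon_psi fs) [(0,0,0), (1,0,0), (0,1,0), (0,0,1)]"

lemma dixon_rows_cubic:
  assumes R: "unital_subring R" and fs: "length fs = 4" "set fs \<subseteq> bounded_mpolys R {1, 2, 3} 2"
    and g: "g \<in> set (dixon_rows fs)"
  shows "g \<in> bounded_mpolys R {1, 2, 3} 3"
proof -
  interpret filtered_ring "bounded_mpolys R {1, 2, 3}"
    by (rule filtered_ring_bounded_mpolys[OF R])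
  have nth: "fs ! i \<in> bounded_mpolys R {1, 2, 3} 2" if "i < 4" for i
    using fs that by (metis nth_mem subsetD)
  have "f \<in> bounded_mpolys R {1, 2, 3} 3" if "f \<in> set fs" for f
    using that fs mono[of 2 3] by auto
  moreover have "Var i * f \<in> bounded_mpolys R {1, 2, 3} 3" if "f \<in> set fs" "i \<in> {1, 2, 3}" for i f
    using mult_mem[OF Var_mem_bounded_mpolys[OF R that(2)], of f 2] that(1) fs(2) unfolding subset_iff
    by (simp only: one_plus_numeral add_num_simps)
  ultimately show ?thesis
    using g dixon_psi_cubic[OF R nth] unfolding dixon_rows_def by auto
qed

lemma dixon_rows_vanish:
  assumes hom: "comm_ring_hom \<phi>" and fs: "length fs = 4" "\<And>f. f \<in> set fs \<Longrightarrow> mpoly_eval \<phi> s f = 0"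
    and g: "g \<in> set (dixon_rows fs)"
  shows "mpoly_eval \<phi> s g = 0"
proof -
  have "mpoly_eval \<phi> s (dixon_psi fs e) = 0" for e
    using fs by (intro dixon_psi_vanishes[OF hom]) auto
  then show ?thesis
    using g fs(2) by (auto simp: dixon_rows_def comm_ring_hom.mpoly_eval_mult[OF hom])
qed

lemma length_cubic_exponents: "length cubic_exponents = 20"
  by (simp add: cubic_exponents_def)

lemma dixon_matrix_altdef:
  "dixon_matrix f1 f2 f3 f4 = mat 20 20 (\<lambda>(i, j).
     Poly_Mapping.lookup (dixon_rows [f1, f2, f3, f4] ! i) (pp (cubic_exponents ! j)))"
proof -
  have "length (dixon_rows [f1, f2, f3, f4]) = 20" by (simp add: dixon_rows_def)
  then show ?thesis
    unfolding dixon_matrix_def Let_def dixon_rows_def[symmetric]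
    by (intro eq_matI) (simp_all add: mat_of_rows_list_def coeff_row_def length_cubic_exponents)
qed

lemma lookup_pp:
  "Poly_Mapping.lookup (pp (a, b, c)) i = (if i = 1 then a else if i = 2 then b else if i = 3 then c else 0)"
  by (simp add: pp_def lookup_add lookup_single when_def)

lemma inj_pp: "inj pp"
proof (rule injI, safe)
  fix a b c a' b' c' :: nat
  assume "pp (a, b, c) = pp (a', b', c')"
  then have "Poly_Mapping.lookup (pp (a, b, c)) i = Poly_Mapping.lookup (pp (a', b', c')) i" for i
    by simp
  from this[of 1] this[of 2] this[of 3] show "a = a'" "b = b'" "c = c'"
    by (simp_all add: lookup_pp)
qed

text \<open>
  The list of exponents is exhaustive, so no coefficient of a cubic is lost in the Dixon matrix.
\<close>

lemma cubic_pp: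
  assumes "Poly_Mapping.keys m \<subseteq> {1, 2, 3}" "pp_degree m \<le> 3"
  shows "m \<in> pp ` set cubic_exponents"
proof
  let ?e = "(Poly_Mapping.lookup m 1, Poly_Mapping.lookup m 2, Poly_Mapping.lookup m 3)"
  show "m = pp ?e"
    using assms(1) by (intro poly_mapping_eqI) (auto simp: lookup_pp in_keys_iff)
  have "a + b + c \<le> 3 \<Longrightarrow> (a, b, c) \<in> set cubic_exponents" for a b c
  proof -
    assume *: "a + b + c \<le> 3"
    then have "a \<in> {0, 1, 2, 3}" "b \<in> {0, 1, 2, 3}" "c \<in> {0, 1, 2, 3}" by auto
    with * show ?thesis
      by (elim insertE emptyE) (simp_all add: cubic_exponents_def)
  qed
  moreover have "Poly_Mapping.lookup m 1 + Poly_Mapping.lookup m 2 + Poly_Mapping.lookup m 3 \<le> 3"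
    using assms(2) by (simp add: pp_degree_superset[OF _ assms(1)])
  ultimately show "?e \<in> set cubic_exponents" by blast
qed

lemma mpoly_eval_cubic:
  assumes g: "g \<in> bounded_mpolys R {1, 2, 3} 3" and "comm_ring_hom \<phi>"
  shows "mpoly_eval \<phi> s g = (\<Sum>j<20. \<phi> (Poly_Mapping.lookup g (pp (cubic_exponents ! j))) *
           pp_eval s (pp (cubic_exponents ! j)))"
proof -
  interpret comm_ring_hom \<phi> by fact
  let ?t = "\<lambda>m. \<phi> (Poly_Mapping.lookup g m) * pp_eval s m"
  have "Poly_Mapping.keys g \<subseteq> pp ` set cubic_exponents"
    using cubic_pp bounded_mpolysD(2,3)[OF g] by blast
  then have "mpoly_eval \<phi> s g = sum ?t (pp ` set cubic_exponents)"
    unfolding mpoly_eval_pp_eval by (intro sum.mono_neutral_left) (auto simp: in_keys_iff)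
  also have "\<dots> = (\<Sum>e\<in>set cubic_exponents. ?t (pp e))"
    using inj_on_subset[OF inj_pp] by (subst sum.reindex) auto
  also have "\<dots> = (\<Sum>e\<leftarrow>cubic_exponents. ?t (pp e))"
    by (rule sum_list_distinct_conv_sum_set[symmetric]) (simp add: cubic_exponents_def)
  also have "\<dots> = (\<Sum>j<20. ?t (pp (cubic_exponents ! j)))"
    by (simp add: sum_list_sum_nth lessThan_atLeast0 length_cubic_exponents)
  finally show ?thesis .
qed

lemma det_dixon_matrix_mem:
  assumes R: "unital_subring R" and fs: "{f1, f2, f3, f4} \<subseteq> bounded_mpolys R {1, 2, 3} 2"
  shows "det (dixon_matrix f1 f2 f3 f4) \<in> R"
proof -
  interpret filtered_ring "\<lambda>_. R" by (rule R)
  have "Poly_Mapping.lookup (dixon_rows [f1, f2, f3, f4] ! i) m \<in> R" if "i < 20" for i m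
  proof -
    have "dixon_rows [f1, f2, f3, f4] ! i \<in> bounded_mpolys R {1, 2, 3} 3"
      using fs that by (intro dixon_rows_cubic[OF R, of "[f1, f2, f3, f4]"] nth_mem)
        (auto simp: dixon_rows_def)
    then show ?thesis by (simp add: bounded_mpolys_iff mpolys_over_def)
  qed
  then show ?thesis
    by (intro det_mem[where n = 20]) (auto simp: dixon_matrix_altdef)
qed

text \<open>
  Here \<open>\<phi>\<close> specialises the parameters in the coefficients. Row \<open>i\<close> of the specialised matrix times
  the vector of monomials at \<open>s\<close> is the value of the \<open>i\<close>-th row polynomial at \<open>s\<close>, which is
  zero.
\<close>

lemma det_dixon_matrix_vanishes:
  assumes hom: "comm_ring_hom \<phi>"
    and fs: "{f1, f2, f3, f4} \<subseteq> bounded_mpolys UNIV {1, 2, 3} 2"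
    and zero: "\<And>f. f \<in> {f1, f2, f3, f4} \<Longrightarrow> mpoly_eval \<phi> s f = 0"
  shows "\<phi> (det (dixon_matrix f1 f2 f3 f4)) = 0"
proof -
  interpret comm_ring_hom \<phi> by (rule hom)
  define A where "A = map_mat \<phi> (dixon_matrix f1 f2 f3 f4)"
  define v where "v = vec 20 (\<lambda>j. pp_eval s (pp (cubic_exponents ! j)))"
  have A: "A \<in> carrier_mat 20 20" by (simp add: A_def dixon_matrix_altdef)
  have "(A *\<^sub>v v) $ i = 0" if i: "i < 20" for i
  proof -
    let ?g = "dixon_rows [f1, f2, f3, f4] ! i"
    have g: "?g \<in> set (dixon_rows [f1, f2, f3, f4])"
      using i by (intro nth_mem) (simp add: dixon_rows_def)
    have "(A *\<^sub>v v) $ i = (\<Sum>j<20. \<phi> (Poly_Mapping.lookup ?g (pp (cubic_exponents ! j))) *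
           pp_eval s (pp (cubic_exponents ! j)))"
      using i by (simp add: A_def v_def dixon_matrix_altdef scalar_prod_def lessThan_atLeast0)
    also have "\<dots> = mpoly_eval \<phi> s ?g"
      using fs by (intro mpoly_eval_cubic[symmetric, OF dixon_rows_cubic[OF subring_UNIV _ _ g] hom]) auto
    also have "\<dots> = 0"
      using zero by (intro dixon_rows_vanish[OF hom _ _ g]) auto
    finally show ?thesis .
  qed
  then have "det A * v $ 19 = 0"
    using det_mult_vec_index[OF A, of v 19] by (simp add: v_def)
  \<comment> \<open>The last of the twenty monomials is \<open>1\<close>.\<close>
  moreover have "v $ 19 = 1"
    by (simp add: v_def cubic_exponents_def pp_def)
  ultimately show ?thesis by (simp add: A_def)
qed

text \<open>
  A monomial can only lose degree when \<open>q\<^sub>0\<close> moves into the coefficients.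
\<close>

lemma q0_as_parameter_quadric:
  assumes K: "unital_subring K" and f: "f \<in> mpolys_over K {0, 1, 2, 3}" "total_degree f \<le> 2"
  shows "q0_as_parameter f \<in> bounded_mpolys (polys_over K) {1, 2, 3} 2"
proof -
  have R: "unital_subring (polys_over K)" by (rule subring_polys_over[OF K])
  interpret K: filtered_ring "\<lambda>_. K" by (rule K)
  interpret filtered_ring "bounded_mpolys (polys_over K) {1, 2, 3}"
    by (rule filtered_ring_bounded_mpolys[OF R])
  have const: "[:c:] \<in> polys_over K" if "c \<in> K" for c
    using that K.zero_mem by (auto simp: polys_over_def coeff_pCons split: nat.split)
  have q0: "[:0, 1:] \<in> polys_over K"
    using K.zero_mem K.one_mem by (auto simp: polys_over_def coeff_pCons split: nat.split)
  have "pp_degree m \<le> 2" if "m \<in> Poly_Mapping.keys f" for m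
  proof -
    have "pp_degree m \<le> total_degree f"
      unfolding total_degree_def pp_degree_def using that by (intro Max_ge) auto
    with f(2) show ?thesis by simp
  qed
  moreover have "(if i = 0 then Const [:0, 1:] else Var i) \<in> bounded_mpolys (polys_over K) {1, 2, 3} 1"
    if "i \<in> {0, 1, 2, 3}" for i
    using that Var_mem_bounded_mpolys[OF R, of i "{1, 2, 3}"] Const_mem_bounded_mpolys[OF R q0]
    by (auto split: if_splits)
  ultimately show ?thesis
    unfolding q0_as_parameter_def using f(1) Const_mem_bounded_mpolys[OF R const]
    by (intro mpoly_eval_mem[where w = 1]) (auto simp: mpolys_over_def subset_iff)
qed

lemma comm_ring_hom_poly_map_poly:
  assumes "comm_ring_hom \<phi>"
  shows "comm_ring_hom (\<lambda>p. poly (map_poly \<phi> p) x)"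
proof -
  interpret comm_ring_hom \<phi> by fact
  have add: "map_poly \<phi> (p + q) = map_poly \<phi> p + map_poly \<phi> q" for p q
    by (intro poly_eqI) (simp add: coeff_map_poly hom_add)
  have mult: "map_poly \<phi> (p * q) = map_poly \<phi> p * map_poly \<phi> q" for p q
    by (intro poly_eqI) (simp add: coeff_map_poly coeff_mult hom_sum hom_mult)
  show ?thesis
    by standard (simp_all add: add mult map_poly_pCons)
qed

theorem theorem3:
  fixes m :: nat
    and f1 f2 f3 f4 :: "ratfun mpoly"
    and s0 s1 s2 s3 :: "ratfun alg_closure"
  assumes "{f1, f2, f3, f4} \<subseteq> mpolys_over (ratfun_field m) {0, 1, 2, 3}"
    and "\<forall>f\<in>{f1, f2, f3, f4}. total_degree f \<le> 2"
    and "(s0, s1, s2, s3) \<in> common_zeros m {f1, f2, f3, f4}"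
  shows "det (dixon_matrix_q f1 f2 f3 f4) \<in> polys_over (ratfun_field m)
    \<and> poly (map_poly to_ac (det (dixon_matrix_q f1 f2 f3 f4))) s0 = 0"
proof
  have quadrics: "{q0_as_parameter f1, q0_as_parameter f2, q0_as_parameter f3, q0_as_parameter f4}
      \<subseteq> bounded_mpolys (polys_over (ratfun_field m)) {1, 2, 3} 2"
    using assms(1,2) q0_as_parameter_quadric[OF subring_ratfun_field] by auto
  show "det (dixon_matrix_q f1 f2 f3 f4) \<in> polys_over (ratfun_field m)"
    unfolding dixon_matrix_q_def
    by (rule det_dixon_matrix_mem[OF subring_polys_over[OF subring_ratfun_field] quadrics])

  define \<phi> where "\<phi> = (\<lambda>p :: ratfun poly. poly (map_poly to_ac p) s0)"
  have "comm_ring_hom (to_ac :: ratfun \<Rightarrow> ratfun alg_closure)"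
    by standard auto
  then interpret \<phi>: comm_ring_hom \<phi>
    unfolding \<phi>_def by (rule comm_ring_hom_poly_map_poly)
  let ?s = "(!) [s0, s1, s2, s3]"
  interpret ev: comm_ring_hom "mpoly_eval \<phi> ?s"
    by (rule \<phi>.comm_ring_hom_mpoly_eval)
  \<comment> \<open>Evaluating in \<open>q\<^sub>0\<close> and then in the other unknowns is evaluating in all four of them.\<close>
  have "mpoly_eval \<phi> ?s (q0_as_parameter f) = mpoly_eval to_ac ?s f" for f
  proof -
    have "\<phi> [:c:] = to_ac c" for c by (simp add: \<phi>_def map_poly_pCons)
    moreover have "mpoly_eval \<phi> ?s (if i = 0 then Const [:0, 1:] else Var i) = ?s i" for i
      by (simp add: \<phi>.mpoly_eval_Const \<phi>.mpoly_eval_Var) (simp add: \<phi>_def map_poly_pCons)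
    ultimately show ?thesis
      by (simp add: q0_as_parameter_def ev.hom_mpoly_eval \<phi>.mpoly_eval_Const)
  qed
  then have zeros: "mpoly_eval \<phi> ?s f = 0"
    if "f \<in> {q0_as_parameter f1, q0_as_parameter f2, q0_as_parameter f3, q0_as_parameter f4}" for f
    using that assms(3) by (auto simp: common_zeros_def)
  have "{q0_as_parameter f1, q0_as_parameter f2, q0_as_parameter f3, q0_as_parameter f4}
      \<subseteq> bounded_mpolys UNIV {1, 2, 3} 2"
    using quadrics by (auto simp: bounded_mpolys_iff mpolys_over_def)
  from det_dixon_matrix_vanishes[OF \<phi>.comm_ring_hom_axioms this zeros]
  show "poly (map_poly to_ac (det (dixon_matrix_q f1 f2 f3 f4))) s0 = 0"
    by (simp add: \<phi>_def dixon_matrix_q_def)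
qed

end
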